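(* Let $\overline E=(E,\|\cdot\|)$ be a normed lattice of rank $n\ge 1$. Then $$-\pi -\log n! +\frac{n}{2} \log \left( \frac{2}{ e\pi}\right) - n\log n + \log\left(1-\frac{1}{2\pi}\right) \;\leq\; \widehat h^0(\overline E)+\sum_{i=1}^n \log \min(\lambda_i(\overline E),1)\;\leq\; 2 \pi -2\log\left(1-\frac{1}{2\pi}\right)+\frac{3n}{2}\log n.$$
   Context: A normed lattice $\overline{E}=(E,\|\cdot\|)$ of rank $n$ is a free $\mathbb{Z}$-module $E$ of rank $n$ together with a norm $\|\cdot\|$ (not necessarily Euclidean) on $E_{\mathbb R}=E\otimes_{\mathbb Z}\mathbb{R}$; $E$ is viewed as a lattice in $E_{\mathbb R}$. $\widehat{h}^0(\overline{E})=\log\#\{m\in E\mid \|m\|\le 1\}$. For $i=1,\dots,n$, the $i$-th successive minimum $\lambda_i(\overline{E})$ is the infimum of all $r>0$ such that the real span of $E\cap\{m\in E_{\mathbb R}\mid \|m\|\le r\}$ has dimension at least $i$. *)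

theory Defs
  imports Complex_Main
begin

definition norm_on :: "'a::real_vector set \<Rightarrow> ('a \<Rightarrow> real) \<Rightarrow> bool" where
  "norm_on V N \<longleftrightarrow>
     (\<forall>x\<in>V. 0 \<le> N x) \<and>
     (\<forall>x\<in>V. N x = 0 \<longleftrightarrow> x = 0) \<and>
     (\<forall>x\<in>V. \<forall>y\<in>V. N (x + y) \<le> N x + N y) \<and>
     (\<forall>c. \<forall>x\<in>V. N (c *\<^sub>R x) = \<bar>c\<bar> * N x)"

text \<open>
  A free \<open>\<int>\<close>-module \<open>E\<close> of rank \<open>n\<close> is represented by its image in \<open>E \<otimes> \<real>\<close>, and \<open>E \<otimes> \<real>\<close> by the
  real subspace \<open>span E\<close> of an ambient real vector space (of arbitrary, possibly infinite,
  dimension). Independence of the \<open>\<int>\<close>-basis \<open>B\<close> over \<open>\<real>\<close> is what makes \<open>span E\<close> the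
  tensor product. The norm is only constrained on \<open>span E\<close>.
\<close>

definition normed_lattice :: "'a::real_vector set \<Rightarrow> ('a \<Rightarrow> real) \<Rightarrow> nat \<Rightarrow> bool" where
  "normed_lattice E N n \<longleftrightarrow>
     (\<exists>B. finite B \<and> card B = n \<and> independent B \<and>
          E = {(\<Sum>b\<in>B. of_int (c b) *\<^sub>R b) | c :: 'a \<Rightarrow> int. True}) \<and>
     norm_on (span E) N"

definition h0_hat :: "'a::real_vector set \<Rightarrow> ('a \<Rightarrow> real) \<Rightarrow> real" where
  "h0_hat E N = ln (real (card {m \<in> E. N m \<le> 1}))"

definition succ_min :: "'a::real_vector set \<Rightarrow> ('a \<Rightarrow> real) \<Rightarrow> nat \<Rightarrow> real" where
  "succ_min E N i =
     Inf {r. r > 0 \<and> dim (span (E \<inter> {m \<in> span E. N m \<le> r})) \<ge> i}"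

end

theory Submission
  imports Defs "HOL-Library.FuncSet"
begin

text \<open>
  Let \<open>M\<close> be the number of lattice points of norm at most 1. For the lower bound, take independent
  lattice vectors \<open>v\<^sub>i\<close> of norm at most \<open>\<lambda>\<^sub>i\<close> and count the combinations of those with \<open>\<lambda>\<^sub>i \<le> 1\<close> whose
  coefficients are bounded by \<open>1 / (n \<lambda>\<^sub>i)\<close>; this gives \<open>M \<Prod> min(\<lambda>\<^sub>i, 1) \<ge> n\<^sup>-\<^sup>n\<close>. For the upper bound,
  the differences of points of norm at most 1 have norm at most 2. By pigeonhole modulo 2 in the
  subgroup spanned by the points of norm at most \<open>2 / 2\<^sup>a\<close>, whose rank is the number \<open>d\<^sub>a\<close> of \<open>\<lambda>\<^sub>i\<close> below
  that value, one loses a factor of at most \<open>2\<close> to the power \<open>d\<^sub>a\<close> while halving the diameter. Once the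
  diameter is below \<open>\<lambda>\<^sub>1\<close> a single point is left. The product of these factors over \<open>a\<close> is at most
  \<open>4\<^sup>n / \<Prod> min(\<lambda>\<^sub>i, 1)\<close>.
\<close>

section \<open>Integer spans, additive subgroups and their bases\<close>

definition int_span :: "'a::real_vector set \<Rightarrow> 'a set" where
  "int_span B = {(\<Sum>b\<in>B. of_int (c b) *\<^sub>R b) | c :: 'a \<Rightarrow> int. True}"

lemma int_spanI: "(\<Sum>b\<in>B. of_int (c b) *\<^sub>R b) \<in> int_span B"
  unfolding int_span_def by blast

lemma zero_in_int_span: "0 \<in> int_span B"
  using int_spanI[of "\<lambda>_. 0" B] by simp

lemma int_span_diff:
  assumes "x \<in> int_span B" "y \<in> int_span B"
  shows "x - y \<in> int_span B"
proof -
  obtain c e where "x = (\<Sum>b\<in>B. of_int (c b) *\<^sub>R b)" "y = (\<Sum>b\<in>B. of_int (e b) *\<^sub>R b)"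
    using assms unfolding int_span_def by blast
  then have "x - y = (\<Sum>b\<in>B. of_int (c b - e b) *\<^sub>R b)"
    by (simp add: sum_subtractf scaleR_left_diff_distrib)
  then show ?thesis by (metis (no_types) int_spanI)
qed

lemma int_span_superset:
  assumes "finite B" shows "B \<subseteq> int_span B"
proof
  fix x assume x: "x \<in> B"
  have "(\<Sum>b\<in>B. of_int (if b = x then 1 else 0) *\<^sub>R b) = (\<Sum>b\<in>B. if b = x then b else 0)"
    by (intro sum.cong) auto
  also have "\<dots> = x" using assms x by simp
  finally show "x \<in> int_span B" by (metis (no_types) int_spanI)
qed

lemma int_span_subset_span: "int_span B \<subseteq> span B"
  unfolding int_span_def by (auto intro: span_sum span_scale span_base)

lemma span_int_span: "finite B \<Longrightarrow> span (int_span B) = span B"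
  by (metis int_span_superset int_span_subset_span span_eq span_superset subset_trans)

lemma int_span_insert:
  assumes "finite B" "b \<notin> B"
  shows "int_span (insert b B) = {of_int k *\<^sub>R b + x | k x. x \<in> int_span B}"
proof (intro equalityI subsetI)
  fix y assume "y \<in> int_span (insert b B)"
  then show "y \<in> {of_int k *\<^sub>R b + x | k x. x \<in> int_span B}"
    unfolding int_span_def using assms by auto
next
  fix y assume "y \<in> {of_int k *\<^sub>R b + x | k x. x \<in> int_span B}"
  then obtain k c where y: "y = of_int k *\<^sub>R b + (\<Sum>b\<in>B. of_int (c b) *\<^sub>R b)"
    unfolding int_span_def by blast
  have "(\<Sum>a\<in>B. of_int (c a) *\<^sub>R a) = (\<Sum>a\<in>B. of_int ((c(b := k)) a) *\<^sub>R a)"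
    using assms by (intro sum.cong) auto
  then have "y = (\<Sum>a\<in>insert b B. of_int ((c(b := k)) a) *\<^sub>R a)"
    unfolding y using assms by simp
  then show "y \<in> int_span (insert b B)" by (metis (no_types) int_spanI)
qed

text \<open>Sublattices such as \<open>E \<inter> span (short r)\<close> come without a basis, so
  they are first handled as bare additive subgroups; closure under differences already yields
  negatives, sums and integer multiples.\<close>

locale int_subgroup =
  fixes G :: "'a::real_vector set"
  assumes zero: "0 \<in> G" and diff: "x \<in> G \<Longrightarrow> y \<in> G \<Longrightarrow> x - y \<in> G"
begin

lemma uminus: "x \<in> G \<Longrightarrow> - x \<in> G"
  using diff[of 0 x] zero by simp

lemma add: "x \<in> G \<Longrightarrow> y \<in> G \<Longrightarrow> x + y \<in> G"
  using diff[of x "- y"] uminus by simp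

lemma scale: "x \<in> G \<Longrightarrow> of_int k *\<^sub>R x \<in> G"
proof (induction k rule: int_induct[where k = 0])
  case base then show ?case using zero by simp
next
  case (step1 i) then show ?case using add[of "of_int i *\<^sub>R x" x] by (simp add: scaleR_left_distrib)
next
  case (step2 i) then show ?case using diff[of "of_int i *\<^sub>R x" x] by (simp add: scaleR_left_diff_distrib)
qed

lemma sum: "(\<And>i. i \<in> I \<Longrightarrow> f i \<in> G) \<Longrightarrow> (\<Sum>i\<in>I. f i) \<in> G"
  by (induction I rule: infinite_finite_induct) (auto simp: zero add)

end

lemma int_subgroup_int_span: "int_subgroup (int_span B)"
  by standard (auto intro: zero_in_int_span int_span_diff)

lemma int_subgroup_Int:
  "int_subgroup G \<Longrightarrow> int_subgroup H \<Longrightarrow> int_subgroup (G \<inter> H)"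
  unfolding int_subgroup_def by auto

lemma int_subgroup_span: "int_subgroup (span S)"
  by standard (auto intro: span_zero span_diff)

text \<open>Induction on \<open>B\<close>. The part of \<open>G\<close> inside
  \<open>int_span B\<close> has a basis \<open>C\<close>; if \<open>G\<close> is larger, one further
  vector \<open>g\<close> with smallest positive coefficient at \<open>b\<close> completes it. The
  basis is independent over the reals, so its size can later be compared with a real
  dimension.\<close>

lemma int_subgroup_basis:
  assumes "finite B" "independent B" "int_subgroup G" "G \<subseteq> int_span B"
  obtains C where "finite C" "independent C" "G = int_span C"
proof -
  have "\<exists>C. finite C \<and> independent C \<and> G = int_span C"
    using assms
  proof (induction B arbitrary: G rule: finite_induct)
    case empty
    then have "G = {0}" unfolding int_span_def int_subgroup_def by auto
    then have "G = int_span {}" unfolding int_span_def by auto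
    then show ?case using independent_empty by blast
  next
    case (insert b B)
    interpret G: int_subgroup G by fact
    have bB: "b \<notin> span B" and indB: "independent B"
      using insert.prems(1) insert.hyps by (auto simp: independent_insert)
    have "int_subgroup (G \<inter> int_span B)"
      by (intro int_subgroup_Int int_subgroup_int_span insert.prems)
    then obtain C where C: "finite C" "independent C" "G \<inter> int_span B = int_span C"
      using insert.IH[OF indB, of "G \<inter> int_span B"] by auto
    note decomp = int_span_insert[OF insert.hyps(1,2)]
    \<comment> \<open>The image of \<open>G\<close> under the coordinate at \<open>b\<close>: a
      subgroup of the integers, hence either trivial or generated by its least positive element
      \<open>m\<close>.\<close>
    define D where "D = {k::int. \<exists>x\<in>int_span B. of_int k *\<^sub>R b + x \<in> G}"
    have Dd: "k - l \<in> D" if k: "k \<in> D" and l: "l \<in> D" for k l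
    proof -
      obtain x y where x: "x \<in> int_span B" "of_int k *\<^sub>R b + x \<in> G"
        and y: "y \<in> int_span B" "of_int l *\<^sub>R b + y \<in> G"
        using k l unfolding D_def by blast
      have "of_int (k - l) *\<^sub>R b + (x - y) \<in> G"
        using G.diff[OF x(2) y(2)] by (simp add: algebra_simps)
      then show ?thesis unfolding D_def using int_span_diff[OF x(1) y(1)] by blast
    qed
    show ?case
    proof (cases "D \<subseteq> {0}")
      case True
      have "G \<subseteq> int_span B"
      proof
        fix y assume y: "y \<in> G"
        then obtain k x where "x \<in> int_span B" "y = of_int k *\<^sub>R b + x"
          using insert.prems(3) decomp by blast
        with y True show "y \<in> int_span B" unfolding D_def by fastforce
      qed
      then show ?thesis using C by (metis inf.absorb1)
    next
      case False
      then obtain k where "k \<in> D" "k \<noteq> 0" by blast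
      moreover from this have "0 - k \<in> D" using Dd by (metis diff_self)
      ultimately obtain k where "k \<in> D" "k > 0" by (metis diff_0 neg_0_less_iff_less not_less_iff_gr_or_eq)
      then have ex: "\<exists>m. int m \<in> D \<and> m > 0" by (intro exI[of _ "nat k"]) auto
      define m where "m = (LEAST m. int m \<in> D \<and> m > 0)"
      have m: "int m \<in> D" "m > 0" using LeastI_ex[OF ex] unfolding m_def by auto
      have least: "j = 0" if "int j \<in> D" "j < m" for j
        using not_less_Least[of j "\<lambda>m. int m \<in> D \<and> m > 0"] that unfolding m_def by auto
      obtain x where x: "x \<in> int_span B" "of_int (int m) *\<^sub>R b + x \<in> G"
        using m unfolding D_def by blast
      define g where "g = of_int (int m) *\<^sub>R b + x"
      have gG: "g \<in> G" using x g_def by simp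
      have CB: "span C \<subseteq> span B"
        by (metis C(1,3) inf_le2 span_int_span insert.hyps(1) span_mono)
      have gC: "g \<notin> span C"
      proof
        assume "g \<in> span C"
        then have "g - x \<in> span B" using CB x int_span_subset_span span_diff by blast
        then have "of_int (int m) *\<^sub>R b \<in> span B" by (simp add: g_def)
        then have "(1 / real m) *\<^sub>R (of_int (int m) *\<^sub>R b) \<in> span B" by (rule span_scale)
        then show False using bB m by simp
      qed
      then have gC': "g \<notin> C" using span_base by blast
      have "G = int_span (insert g C)"
      proof (intro equalityI subsetI)
        fix y assume y: "y \<in> G"
        then obtain k z where z: "z \<in> int_span B" "y = of_int k *\<^sub>R b + z"
          using insert.prems(3) decomp by blast
        \<comment> \<open>Division with remainder: subtracting \<open>q\<close> copies of
          \<open>g\<close> leaves the coefficient \<open>k mod int m\<close> at \<open>b\<close>,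
          which minimality of \<open>m\<close> forces to be 0. What remains lies in
          \<open>int_span B\<close>, hence in \<open>int_span C\<close>.\<close>
        define q where "q = k div int m"
        have k: "k - q * int m = k mod int m" unfolding q_def by (simp add: minus_div_mult_eq_mod)
        have yG: "y - of_int q *\<^sub>R g \<in> G" using G.diff[OF y G.scale[OF gG]] .
        have e: "y - of_int q *\<^sub>R g = of_int (k - q * int m) *\<^sub>R b + (z - of_int q *\<^sub>R x)"
          unfolding z g_def by (simp add: algebra_simps)
        have s: "z - of_int q *\<^sub>R x \<in> int_span B"
          by (intro int_span_diff z int_subgroup.scale int_subgroup_int_span x)
        have "k mod int m \<in> D" unfolding D_def using yG e s k by auto
        moreover have "0 \<le> k mod int m" "k mod int m < int m" using m by auto
        ultimately have "k mod int m = 0"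
          using least[of "nat (k mod int m)"] by (simp add: nat_less_iff)
        then have "y - of_int q *\<^sub>R g \<in> int_span C"
          using e s yG k C(3) by auto
        moreover have "y = of_int q *\<^sub>R g + (y - of_int q *\<^sub>R g)" by simp
        ultimately show "y \<in> int_span (insert g C)"
          unfolding int_span_insert[OF C(1) gC'] by blast
      next
        fix y assume "y \<in> int_span (insert g C)"
        then obtain k z where "z \<in> int_span C" "y = of_int k *\<^sub>R g + z"
          unfolding int_span_insert[OF C(1) gC'] by blast
        then show "y \<in> G" using C(3) G.add G.scale gG by blast
      qed
      moreover have "independent (insert g C)" using gC C by (simp add: independent_insert)
      ultimately show ?thesis using C(1) by blast
    qed
  qed
  then show ?thesis using that by blast
qed

text \<open>One coefficient vector is chosen for each point, and \<open>p x\<close> collects its odd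
  positions; equal sets make all coefficients of the difference even. Subsets of \<open>C\<close>
  thus serve as pigeonhole labels for classes modulo 2.\<close>

lemma int_span_parity:
  obtains p where "\<And>x. p x \<subseteq> C"
    "\<And>x y. x \<in> int_span C \<Longrightarrow> y \<in> int_span C \<Longrightarrow> p x = p y \<Longrightarrow> \<exists>z\<in>int_span C. x - y = 2 *\<^sub>R z"
proof -
  have "\<forall>x\<in>int_span C. \<exists>c::'a \<Rightarrow> int. x = (\<Sum>b\<in>C. of_int (c b) *\<^sub>R b)"
    unfolding int_span_def by blast
  then obtain c :: "'a \<Rightarrow> 'a \<Rightarrow> int"
    where c: "\<And>x. x \<in> int_span C \<Longrightarrow> x = (\<Sum>b\<in>C. of_int (c x b) *\<^sub>R b)"
    by metis
  define p where "p x = {b\<in>C. odd (c x b)}" for x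
  have "\<exists>z\<in>int_span C. x - y = 2 *\<^sub>R z"
    if xy: "x \<in> int_span C" "y \<in> int_span C" and pp: "p x = p y" for x y
  proof -
    have ev: "even (c x b - c y b)" if "b \<in> C" for b
      using pp that unfolding p_def by (simp add: set_eq_iff) blast
    define z where "z = (\<Sum>b\<in>C. of_int ((c x b - c y b) div 2) *\<^sub>R b)"
    have "x - y = (\<Sum>b\<in>C. of_int (c x b - c y b) *\<^sub>R b)"
      using c[OF xy(1)] c[OF xy(2)] by (simp add: sum_subtractf scaleR_left_diff_distrib)
    also have "\<dots> = (\<Sum>b\<in>C. 2 *\<^sub>R of_int ((c x b - c y b) div 2) *\<^sub>R b)"
    proof (intro sum.cong refl)
      fix b assume "b \<in> C"
      then have "c x b - c y b = 2 * ((c x b - c y b) div 2)" using ev by simp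
      then have "real_of_int (c x b - c y b) = 2 * real_of_int ((c x b - c y b) div 2)"
        by (metis of_int_mult of_int_numeral)
      then show "of_int (c x b - c y b) *\<^sub>R b = 2 *\<^sub>R of_int ((c x b - c y b) div 2) *\<^sub>R b"
        by simp
    qed
    also have "\<dots> = 2 *\<^sub>R z" unfolding z_def by (simp add: scaleR_sum_right)
    finally show ?thesis using int_spanI[of "\<lambda>b. (c x b - c y b) div 2" C] z_def by blast
  qed
  then show ?thesis using that[of p] unfolding p_def by blast
qed

section \<open>Norms on finite-dimensional real spans\<close>

lemma norm_onD:
  assumes "norm_on V N"
  shows "x \<in> V \<Longrightarrow> 0 \<le> N x" "x \<in> V \<Longrightarrow> N x = 0 \<longleftrightarrow> x = 0"
    "x \<in> V \<Longrightarrow> y \<in> V \<Longrightarrow> N (x + y) \<le> N x + N y" "x \<in> V \<Longrightarrow> N (c *\<^sub>R x) = \<bar>c\<bar> * N x"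
  using assms unfolding norm_on_def by auto

lemma norm_on_sum_le:
  assumes "norm_on (span S) N" "\<And>i. i \<in> I \<Longrightarrow> f i \<in> span S"
  shows "N (\<Sum>i\<in>I. f i) \<le> (\<Sum>i\<in>I. N (f i))"
  using assms(2)
proof (induction I rule: infinite_finite_induct)
  case (insert i I)
  then have "N (f i + sum f I) \<le> N (f i) + N (sum f I)"
    by (intro norm_onD(3)[OF assms(1)] span_sum) auto
  then show ?case using insert by force
qed (use norm_onD(2)[OF assms(1) span_zero] in auto)

lemma norm_on_diff_le:
  assumes "norm_on (span S) N" "x \<in> span S" "y \<in> span S"
  shows "N (x - y) \<le> N x + N y"
  using norm_onD(3)[OF assms(1,2), of "(-1) *\<^sub>R y"] norm_onD(4)[OF assms(1,3), of "-1"] assms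
  by (simp add: span_neg)

text \<open>One half of the equivalence of norms in finite dimension, proved by induction on the
  basis. The point is that a new basis vector \<open>b\<close> keeps a positive distance
  \<open>\<delta>\<close> from \<open>span B\<close>, which follows from completeness of the reals
  applied to coordinates.\<close>

lemma norm_on_coeff_bound:
  assumes "finite B" "independent B" "norm_on (span B) N"
  shows "\<exists>K>0. \<forall>x. (\<Sum>b\<in>B. \<bar>x b\<bar>) \<le> K * N (\<Sum>b\<in>B. x b *\<^sub>R b)"
  using assms
proof (induction B rule: finite_induct)
  case empty
  then show ?case using norm_onD(2)[OF empty(2) span_zero] by (intro exI[of _ 1]) simp
next
  case (insert b B)
  note N = norm_onD[OF insert.prems(2)]
  have bB: "b \<notin> span B" and indB: "independent B"
    using insert.prems(1) insert.hyps by (auto simp: independent_insert)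
  have mono: "span B \<subseteq> span (insert b B)" by (rule span_mono) auto
  have b: "b \<in> span (insert b B)" by (simp add: span_base)
  have NB: "norm_on (span B) N"
    using insert.prems(2) mono unfolding norm_on_def by (meson subsetD)
  obtain K where K: "K > 0" "\<And>x. (\<Sum>b\<in>B. \<bar>x b\<bar>) \<le> K * N (\<Sum>b\<in>B. x b *\<^sub>R b)"
    using insert.IH[OF indB NB] by blast
  define L where "L x = (\<Sum>a\<in>B. x a *\<^sub>R a)" for x
  have LB: "L x \<in> span B" for x
    unfolding L_def by (intro span_sum span_scale span_base)
  have LS: "L x \<in> span (insert b B)" for x using LB mono by blast
  have Ldiff: "L x - L y = L (\<lambda>a. x a - y a)" for x y
    unfolding L_def by (simp add: sum_subtractf scaleR_left_diff_distrib)
  have LN: "N (L x) \<le> (\<Sum>a\<in>B. \<bar>x a\<bar> * N a)" for x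
  proof -
    have "N (L x) \<le> (\<Sum>a\<in>B. N (x a *\<^sub>R a))"
      unfolding L_def by (rule norm_on_sum_le[OF NB]) (intro span_scale span_base)
    also have "\<dots> = (\<Sum>a\<in>B. \<bar>x a\<bar> * N a)"
      by (intro sum.cong refl N(4)) (simp add: span_base)
    finally show ?thesis .
  qed
  have "\<exists>\<delta>>0. \<forall>x. \<delta> \<le> N (b - L x)"
  proof (rule ccontr)
    assume "\<not> ?thesis"
    then have "\<forall>k. \<exists>x. N (b - L x) < inverse (real (Suc k))"
      by (meson inverse_positive_iff_positive not_le of_nat_0_less_iff zero_less_Suc)
    then obtain x where x: "\<And>k. N (b - L (x k)) < inverse (real (Suc k))" by metis
    \<comment> \<open>The bound for \<open>B\<close> turns closeness of the points
      \<open>L (x k)\<close> into closeness of their coordinates, so each coordinate is Cauchy. The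
      limits \<open>y\<close> would then give \<open>b = L y\<close>, against independence.\<close>
    have "convergent (\<lambda>k. x k a)" if a: "a \<in> B" for a
    proof -
      have bd: "\<bar>x k a - x l a\<bar> \<le> K * (inverse (real (Suc k)) + inverse (real (Suc l)))" for k l
      proof -
        have "\<bar>x k a - x l a\<bar> \<le> (\<Sum>a\<in>B. \<bar>x k a - x l a\<bar>)"
          using member_le_sum[of a B "\<lambda>a. \<bar>x k a - x l a\<bar>"] a insert.hyps by simp
        also have "\<dots> \<le> K * N (L (x k) - L (x l))"
          using K(2)[of "\<lambda>a. x k a - x l a"] unfolding Ldiff unfolding L_def by simp
        also have "L (x k) - L (x l) = (b - L (x l)) - (b - L (x k))" by simp
        also have "K * N \<dots> \<le> K * (N (b - L (x l)) + N (b - L (x k)))"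
          using K(1) by (intro mult_left_mono norm_on_diff_le[OF insert.prems(2)] span_diff b LS) auto
        also have "\<dots> \<le> K * (inverse (real (Suc k)) + inverse (real (Suc l)))"
          using K(1) x[of k] x[of l] by (intro mult_left_mono) auto
        finally show ?thesis .
      qed
      have "Cauchy (\<lambda>k. x k a)"
      proof (rule metric_CauchyI)
        fix e :: real assume e: "e > 0"
        then obtain M where M: "inverse (real (Suc M)) < e / (2 * K)"
          using reals_Archimedean[of "e / (2 * K)"] K(1) by auto
        have "dist (x k a) (x l a) < e" if "k \<ge> M" "l \<ge> M" for k l
        proof -
          have i: "inverse (real (Suc j)) \<le> inverse (real (Suc M))" if "j \<ge> M" for j
            using that by (intro le_imp_inverse_le) auto
          have "dist (x k a) (x l a) \<le> K * (inverse (real (Suc k)) + inverse (real (Suc l)))"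
            using bd by (simp add: dist_real_def)
          also have "\<dots> < K * (e / (2 * K) + e / (2 * K))"
            using M i[OF that(1)] i[OF that(2)] K(1) by (intro mult_strict_left_mono) linarith+
          also have "\<dots> = e" using K(1) by (simp add: field_simps)
          finally show ?thesis .
        qed
        then show "\<exists>M. \<forall>k\<ge>M. \<forall>l\<ge>M. dist (x k a) (x l a) < e" by blast
      qed
      then show ?thesis by (rule real_Cauchy_convergent)
    qed
    then obtain y where y: "\<And>a. a \<in> B \<Longrightarrow> (\<lambda>k. x k a) \<longlonglongrightarrow> y a"
      unfolding convergent_def by metis
    have "N (b - L y) \<le> inverse (real (Suc k)) + (\<Sum>a\<in>B. \<bar>x k a - y a\<bar> * N a)" for k
    proof -
      have "b - L y = (b - L (x k)) + L (\<lambda>a. x k a - y a)" by (simp flip: Ldiff)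
      then have "N (b - L y) \<le> N (b - L (x k)) + N (L (\<lambda>a. x k a - y a))"
        using N(3)[OF span_diff[OF b LS] LS] by metis
      then show ?thesis using x[of k] LN[of "\<lambda>a. x k a - y a"] by linarith
    qed
    moreover have "(\<lambda>k. inverse (real (Suc k)) + (\<Sum>a\<in>B. \<bar>x k a - y a\<bar> * N a))
        \<longlonglongrightarrow> 0 + (\<Sum>a\<in>B. \<bar>y a - y a\<bar> * N a)"
      by (intro tendsto_intros LIMSEQ_inverse_real_of_nat y)
    ultimately have "N (b - L y) \<le> 0 + (\<Sum>a\<in>B. \<bar>y a - y a\<bar> * N a)"
      by (intro LIMSEQ_le_const) auto
    then have "N (b - L y) = 0" using N(1)[OF span_diff[OF b LS[of y]]] by simp
    then have "b = L y" using N(2)[OF span_diff[OF b LS]] by simp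
    then show False using LB bB by metis
  qed
  then obtain \<delta> where \<delta>: "\<delta> > 0" "\<And>x. \<delta> \<le> N (b - L x)" by blast
  \<comment> \<open>The coefficient \<open>t\<close> at \<open>b\<close> is at most
    \<open>N v / \<delta>\<close>; the others cost \<open>K * N (L x)\<close>, where
    \<open>N (L x)\<close> is at most \<open>N v + \<bar>t\<bar> * N b\<close>. The sum of both
    estimates is \<open>K' * N v\<close>.\<close>
  define K' where "K' = 1 / \<delta> + K * (1 + N b / \<delta>)"
  have Nb: "N b \<ge> 0" using N(1)[OF b] .
  have "(\<Sum>a\<in>insert b B. \<bar>x a\<bar>) \<le> K' * N (\<Sum>a\<in>insert b B. x a *\<^sub>R a)" for x
  proof -
    define t where "t = x b"
    define v where "v = t *\<^sub>R b + L x"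
    have v: "v \<in> span (insert b B)" unfolding v_def by (intro span_add span_scale b LS)
    have 1: "\<bar>t\<bar> \<le> N v / \<delta>"
    proof (cases "t = 0")
      case True then show ?thesis using N(1)[OF v] \<delta> by simp
    next
      case False
      \<comment> \<open>Dividing \<open>v\<close> by \<open>t\<close> exhibits it as
        \<open>b\<close> minus a point of \<open>span B\<close>, to which the distance
        \<open>\<delta>\<close> applies.\<close>
      have "b - L (\<lambda>a. - x a / t) = (1 / t) *\<^sub>R v"
        using False unfolding v_def L_def
        by (simp add: scaleR_right_distrib scaleR_sum_right sum_negf)
      then have "\<delta> \<le> \<bar>1 / t\<bar> * N v" using \<delta>(2) N(4)[OF v] by metis
      then show ?thesis using False \<delta>(1) by (simp add: field_simps)
    qed
    have "N (L x) = N (v - t *\<^sub>R b)" by (simp add: v_def)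
    also have "\<dots> \<le> N v + \<bar>t\<bar> * N b"
      using norm_on_diff_le[OF insert.prems(2) v span_scale[OF b], of t] N(4)[OF b] by simp
    also have "\<dots> \<le> N v + N v / \<delta> * N b" using mult_right_mono[OF 1 Nb] by simp
    finally have "K * N (L x) \<le> K * (N v + N v / \<delta> * N b)" using K(1) by simp
    moreover have "(\<Sum>a\<in>B. \<bar>x a\<bar>) \<le> K * N (L x)" using K(2) unfolding L_def .
    ultimately have "\<bar>t\<bar> + (\<Sum>a\<in>B. \<bar>x a\<bar>) \<le> N v / \<delta> + K * (N v + N v / \<delta> * N b)"
      using 1 by linarith
    also have "\<dots> = K' * N v" unfolding K'_def by (simp add: algebra_simps)
    finally show ?thesis using insert.hyps by (simp add: t_def v_def L_def)
  qed
  moreover have "K' > 0" unfolding K'_def using \<delta>(1) K(1) Nb by (simp add: add_pos_nonneg)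
  ultimately show ?case by blast
qed

section \<open>Dimension, finiteness and dyadic counting\<close>

lemma card_independent_le_dim:
  assumes "finite B" "S \<subseteq> span B" "independent A" "A \<subseteq> span S"
  shows "finite A" "card A \<le> dim S"
proof -
  obtain C where C: "C \<subseteq> S" "independent C" "S \<subseteq> span C" "card C = dim S"
    using real_vector.basis_exists by blast
  \<comment> \<open>An infinite basis would have the default cardinality 0 and make
    \<open>dim S\<close> meaningless; containment in the span of the finite \<open>B\<close>
    excludes this.\<close>
  have "finite C"
    using real_vector.independent_span_bound[OF assms(1) C(2)] C(1) assms(2) by blast
  moreover have "A \<subseteq> span C" using C(3) assms(4) by (meson span_minimal subspace_span subset_trans)
  ultimately show "finite A" "card A \<le> dim S"
    using real_vector.independent_span_bound[OF _ assms(3), of C] C(4) by auto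
qed

lemma dim_mono_finite:
  assumes "finite B" "S \<subseteq> T" "T \<subseteq> span B"
  shows "dim S \<le> dim T"
proof -
  obtain C where C: "C \<subseteq> S" "independent C" "S \<subseteq> span C" "card C = dim S"
    using real_vector.basis_exists by blast
  have "C \<subseteq> span T" using C(1) assms(2) span_superset by blast
  from card_independent_le_dim(2)[OF assms(1,3) C(2) this] C(4) show ?thesis by simp
qed

text \<open>The coefficient bound confines the integer coefficients to the box
  \<open>{- q..q}\<close>. Finiteness is what gives \<open>card\<close> in \<open>h0_hat\<close> its
  intended value.\<close>

lemma finite_int_span_norm_le:
  assumes "finite B" "independent B" "norm_on (span B) N"
  shows "finite {m \<in> int_span B. N m \<le> r}"
proof -
  obtain K where K: "K > 0" "\<And>x. (\<Sum>b\<in>B. \<bar>x b\<bar>) \<le> K * N (\<Sum>b\<in>B. x b *\<^sub>R b)"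
    using norm_on_coeff_bound[OF assms] by blast
  define q where "q = \<lfloor>K * r\<rfloor>"
  have "{m \<in> int_span B. N m \<le> r}
      \<subseteq> (\<lambda>c. \<Sum>b\<in>B. of_int (c b) *\<^sub>R b) ` (B \<rightarrow>\<^sub>E {- q..q})"
  proof
    fix m assume "m \<in> {m \<in> int_span B. N m \<le> r}"
    then obtain c :: "'a \<Rightarrow> int" where m: "m = (\<Sum>b\<in>B. of_int (c b) *\<^sub>R b)" "N m \<le> r"
      unfolding int_span_def by blast
    have "c b \<in> {- q..q}" if b: "b \<in> B" for b
    proof -
      have "real_of_int \<bar>c b\<bar> \<le> (\<Sum>b\<in>B. \<bar>real_of_int (c b)\<bar>)"
        using member_le_sum[of b B "\<lambda>b. \<bar>real_of_int (c b)\<bar>"] b assms(1) by simp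
      also have "\<dots> \<le> K * N m" unfolding m by (rule K)
      also have "\<dots> \<le> K * r" using K(1) m(2) by simp
      finally have "\<bar>c b\<bar> \<le> q" unfolding q_def by (simp add: le_floor_iff)
      then show ?thesis by auto
    qed
    moreover have "m = (\<Sum>b\<in>B. of_int (restrict c B b) *\<^sub>R b)" unfolding m by simp
    ultimately show "m \<in> (\<lambda>c. \<Sum>b\<in>B. of_int (c b) *\<^sub>R b) ` (B \<rightarrow>\<^sub>E {- q..q})"
      by (intro image_eqI[of _ _ "restrict c B"]) auto
  qed
  then show ?thesis by (rule finite_subset) (intro finite_imageI finite_PiE assms(1), auto)
qed

text \<open>A minimum \<open>l\<close> costs a factor 2 at every scale \<open>2 / 2 ^ a\<close> that
  is at least \<open>l\<close>. If \<open>m\<close> is the last such scale, there are at most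
  \<open>m + 1\<close> of them, while \<open>l * 2 ^ m \<le> 2\<close>; the product is therefore at
  most 4.\<close>

lemma two_power_card_times_min_le:
  fixes l :: real
  assumes "l > 0"
  shows "2 ^ card {a. a < J \<and> l \<le> 2 / 2 ^ a} * min l 1 \<le> 4"
proof (cases "{a. a < J \<and> l \<le> 2 / 2 ^ a} = {}")
  case False
  define A where "A = {a. a < J \<and> l \<le> 2 / 2 ^ a}"
  have A: "finite A" "A \<noteq> {}" using False unfolding A_def by auto
  define m where "m = Max A"
  have "m \<in> A" using A m_def by simp
  then have "l * 2 ^ m \<le> 2" unfolding A_def by (simp add: field_simps)
  have "A \<subseteq> {..m}" using A m_def by auto
  then have "card A \<le> Suc m" using card_mono[of "{..m}" A] by simp
  then have "(2::real) ^ card A \<le> 2 ^ Suc m" by (intro power_increasing) auto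
  then have "2 ^ card A * min l 1 \<le> 2 ^ Suc m * l" using assms by (intro mult_mono) auto
  also have "\<dots> \<le> 4" using \<open>l * 2 ^ m \<le> 2\<close> by (simp add: mult.commute)
  finally show ?thesis unfolding A_def .
next
  case True
  then show ?thesis by (simp only: card.empty) auto
qed

section \<open>Short lattice vectors and successive minima\<close>

context
  fixes E :: "'a::real_vector set" and N :: "'a \<Rightarrow> real" and n :: nat
  assumes lattice: "normed_lattice E N n"
begin

definition short :: "real \<Rightarrow> 'a set" where
  "short r = {m \<in> E. N m \<le> r}"

lemma lattice_basis:
  obtains B where "finite B" "card B = n" "independent B" "E = int_span B" "span E = span B"
  using lattice span_int_span unfolding normed_lattice_def int_span_def[symmetric] by metis

lemma norm_span: "norm_on (span E) N"
  using lattice unfolding normed_lattice_def by blast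

lemma int_subgroup_lattice: "int_subgroup E"
  by (metis lattice_basis int_subgroup_int_span)

lemma short_subset: "short r \<subseteq> span E"
  unfolding short_def using span_superset by blast

lemma finite_short: "finite (short r)"
  using lattice_basis norm_span finite_int_span_norm_le unfolding short_def by metis

lemma zero_in_short: "r \<ge> 0 \<Longrightarrow> 0 \<in> short r"
  using int_subgroup.zero[OF int_subgroup_lattice] norm_onD(2)[OF norm_span span_zero]
  unfolding short_def by simp

lemma dim_short_mono: "short r \<subseteq> short s \<Longrightarrow> dim (short r) \<le> dim (short s)"
  by (metis lattice_basis dim_mono_finite short_subset)

lemma card_le_dim_short:
  assumes "independent A" "A \<subseteq> span (short r)"
  shows "finite A" "card A \<le> dim (short r)"
  by (metis lattice_basis card_independent_le_dim short_subset assms)+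

lemma dim_short_le: "dim (short r) \<le> n"
  by (metis lattice_basis real_vector.dim_le_card short_subset)

text \<open>A radius beyond the norms of all basis vectors captures the full rank, so for
  \<open>i \<le> n\<close> the infimum defining the \<open>i\<close>-th minimum runs over a nonempty
  set.\<close>

lemma dim_short_eq: "\<exists>r>0. dim (short r) = n"
proof -
  obtain B where B: "finite B" "card B = n" "independent B" "E = int_span B" "span E = span B"
    by (rule lattice_basis)
  have pos: "N b \<ge> 0" if "b \<in> B" for b
    using norm_onD(1)[OF norm_span] B(5) that span_base by metis
  define r where "r = 1 + (\<Sum>b\<in>B. N b)"
  have "b \<in> short r" if b: "b \<in> B" for b
    using member_le_sum[of b B N] pos b B int_span_superset[of B] unfolding short_def r_def by auto
  then have "n \<le> dim (short r)"
    using card_le_dim_short(2)[OF B(3), of r] B(2) span_superset by blast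
  moreover have "r > 0" unfolding r_def using sum_nonneg[of B N] pos by force
  ultimately show ?thesis using dim_short_le by (metis le_antisym)
qed

lemma succ_min_eq: "succ_min E N i = Inf {r. r > 0 \<and> i \<le> dim (short r)}"
proof -
  have "E \<inter> {m \<in> span E. N m \<le> r} = short r" for r
    unfolding short_def using span_superset by blast
  then show ?thesis unfolding succ_min_def by simp
qed

text \<open>The infimum is attained because norms of lattice points are discrete: just above
  \<open>l\<close> no new point appears. The last claim then turns comparisons with a minimum into
  comparisons of dimensions.\<close>

lemma succ_min_props:
  assumes "1 \<le> i" "i \<le> n"
  shows "succ_min E N i > 0" "i \<le> dim (short (succ_min E N i))"
    "r > 0 \<Longrightarrow> succ_min E N i \<le> r \<longleftrightarrow> i \<le> dim (short r)"
proof -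
  define R where "R = {r. r > 0 \<and> i \<le> dim (short r)}"
  define l where "l = succ_min E N i"
  have l: "l = Inf R" unfolding l_def R_def by (rule succ_min_eq)
  have ne: "R \<noteq> {}" unfolding R_def using dim_short_eq assms by auto
  have bdd: "bdd_below R" unfolding R_def by (rule bdd_belowI[of _ 0]) auto
  \<comment> \<open>The smallest lattice norm above \<open>l\<close>, capped at
    \<open>l + 1\<close>; no lattice point has norm strictly between \<open>l\<close> and
    \<open>s\<close>, so a radius \<open>r0\<close> below \<open>s\<close> captures nothing outside
    \<open>short l\<close>.\<close>
  define s where "s = Min (insert (l + 1) (N ` short (l + 1) \<inter> {l<..}))"
  have "s > l" unfolding s_def using finite_short by (subst Min_gr_iff) auto
  then obtain r0 where r0: "r0 \<in> R" "r0 < s" using cInf_lessD[OF ne] l by metis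
  have "short r0 \<subseteq> short l"
  proof
    fix m assume m: "m \<in> short r0"
    have s: "s \<le> x" if "x \<in> insert (l + 1) (N ` short (l + 1) \<inter> {l<..})" for x
      unfolding s_def using finite_short that by (intro Min_le) auto
    have mm: "N m < s" "m \<in> E" using m r0 unfolding short_def by auto
    have "N m \<le> l"
    proof (rule ccontr)
      assume "\<not> N m \<le> l"
      moreover have "m \<in> short (l + 1)" using mm s[of "l + 1"] unfolding short_def by auto
      ultimately have "s \<le> N m" by (intro s) auto
      then show False using mm by simp
    qed
    then show "m \<in> short l" using mm unfolding short_def by simp
  qed
  then have il: "i \<le> dim (short l)" using r0(1) dim_short_mono[of r0 l] unfolding R_def by simp
  then show "i \<le> dim (short (succ_min E N i))" unfolding l_def .
  show pos: "succ_min E N i > 0"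
  \<comment> \<open>For \<open>l \<le> 0\<close> only the zero vector could lie in
    \<open>short l\<close>, giving dimension 0, whereas \<open>i \<ge> 1\<close>.\<close>
  proof (rule ccontr)
    assume "\<not> ?thesis"
    then have "l \<le> 0" by (simp add: l_def)
    have "m \<in> {0}" if "m \<in> short l" for m
    proof -
      have "m \<in> span E" "N m \<le> 0" using that \<open>l \<le> 0\<close> short_subset unfolding short_def by auto
      then show ?thesis using norm_onD(1,2)[OF norm_span] by fastforce
    qed
    then have "dim (short l) \<le> card ({}::'a set)"
      by (intro real_vector.dim_le_card) auto
    then show False using il assms by simp
  qed
  show "succ_min E N i \<le> r \<longleftrightarrow> i \<le> dim (short r)" if r: "r > 0"
  proof
    assume "succ_min E N i \<le> r"
    then have "short l \<subseteq> short r" unfolding l_def short_def by auto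
    then show "i \<le> dim (short r)" using il dim_short_mono le_trans by blast
  next
    assume "i \<le> dim (short r)"
    then have "r \<in> R" unfolding R_def using r by simp
    then show "succ_min E N i \<le> r" using cInf_lower[OF _ bdd] l l_def by simp
  qed
qed

text \<open>The minima bounded by \<open>r\<close> are exactly those with index in
  \<open>{1..dim (short r)}\<close>. This translates the exponents of the halving argument into the
  minima.\<close>

lemma dim_short_eq_card:
  assumes "r > 0"
  shows "dim (short r) = card {i \<in> {1..n}. succ_min E N i \<le> r}"
proof -
  have "{i \<in> {1..n}. succ_min E N i \<le> r} = {1..dim (short r)}"
    using succ_min_props(3)[OF _ _ assms] dim_short_le[of r] by auto
  then show ?thesis by simp
qed

section \<open>Upper bound by repeated halving\<close>

lemma succ_min_1_le:
  assumes "m \<in> E" "m \<noteq> 0"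
  shows "succ_min E N 1 \<le> N m"
proof -
  have m: "m \<in> span E" using assms span_base by blast
  then have pos: "N m > 0" using norm_onD(1,2)[OF norm_span m] assms by simp
  have "independent {m}" using assms by simp
  moreover have "{m} \<subseteq> span (short (N m))" using assms by (auto simp: short_def intro: span_base)
  ultimately have "1 \<le> dim (short (N m))" using card_le_dim_short(2) by fastforce
  then show ?thesis
    using dim_short_le[of "N m"] succ_min_props(3)[OF _ _ pos, of 1] by auto
qed

text \<open>
  Points of a set of diameter at most \<open>r\<close> that agree modulo \<open>2(E \<inter> span (short r))\<close> become, after
  halving their differences, a set of diameter at most \<open>r / 2\<close>.
\<close>

lemma card_halving:
  assumes W: "W \<subseteq> E" "\<And>x y. x \<in> W \<Longrightarrow> y \<in> W \<Longrightarrow> N (x - y) \<le> r"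
    and half: "\<And>V. V \<subseteq> E \<Longrightarrow> (\<And>x y. x \<in> V \<Longrightarrow> y \<in> V \<Longrightarrow> N (x - y) \<le> r / 2)
      \<Longrightarrow> finite V \<and> card V \<le> k"
  shows "finite W \<and> card W \<le> 2 ^ dim (short r) * k"
proof (cases "W = {}")
  case False
  then obtain x0 where x0: "x0 \<in> W" by blast
  interpret E: int_subgroup E by (rule int_subgroup_lattice)
  \<comment> \<open>\<open>G\<close> contains all differences of points of \<open>W\<close>. Its
    integral basis is independent over the reals, so it has at most \<open>dim (short r)\<close>
    elements, which bounds the number of parity classes.\<close>
  define G where "G = E \<inter> span (short r)"
  obtain B where B: "finite B" "card B = n" "independent B" "E = int_span B" "span E = span B"
    by (rule lattice_basis)
  have sub: "int_subgroup G"
    unfolding G_def by (intro int_subgroup_Int int_subgroup_lattice int_subgroup_span)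
  obtain C where C: "finite C" "independent C" "G = int_span C"
    using int_subgroup_basis[OF B(1,3) sub] B(4) unfolding G_def by auto
  have "C \<subseteq> span (short r)" using int_span_superset[OF C(1)] C(3) G_def by blast
  then have cardC: "card C \<le> dim (short r)" using card_le_dim_short(2)[OF C(2)] by blast
  obtain p where p: "\<And>x. p x \<subseteq> C"
    "\<And>x y. x \<in> G \<Longrightarrow> y \<in> G \<Longrightarrow> p x = p y \<Longrightarrow> \<exists>z\<in>G. x - y = 2 *\<^sub>R z"
    using int_span_parity[of C] C(3) by metis
  have WG: "x - x0 \<in> G" if "x \<in> W" for x
    using W x0 that E.diff unfolding G_def short_def by (blast intro: span_base)
  define F where "F P = {x \<in> W. p (x - x0) = P}" for P
  have F: "finite (F P) \<and> card (F P) \<le> k" for P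
  proof (cases "F P = {}")
    case False
    then obtain y where y: "y \<in> F P" by blast
    \<comment> \<open>The class \<open>F P\<close>, seen from its member \<open>y\<close> and scaled
      by one half: distances in \<open>V\<close> are half of those in \<open>F P\<close>, so
      \<open>half\<close> applies.\<close>
    define V where "V = {z \<in> E. y + 2 *\<^sub>R z \<in> F P}"
    have "F P \<subseteq> (\<lambda>z. y + 2 *\<^sub>R z) ` V"
    proof
      fix x assume x: "x \<in> F P"
      then obtain z where z: "z \<in> G" "(x - x0) - (y - x0) = 2 *\<^sub>R z"
        using p(2)[OF WG WG, of x y] y unfolding F_def by auto
      then have "x = y + 2 *\<^sub>R z" by (simp add: algebra_simps)
      then show "x \<in> (\<lambda>z. y + 2 *\<^sub>R z) ` V"
        using x z(1) unfolding V_def G_def by blast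
    qed
    moreover have "finite V \<and> card V \<le> k"
    proof (rule half)
      show "V \<subseteq> E" unfolding V_def by blast
      fix x z assume xz: "x \<in> V" "z \<in> V"
      then have "x - z \<in> span E" using E.diff span_base unfolding V_def by blast
      then have "2 * N (x - z) = N (2 *\<^sub>R (x - z))"
        using norm_onD(4)[OF norm_span, of "x - z" 2] by simp
      also have "2 *\<^sub>R (x - z) = (y + 2 *\<^sub>R x) - (y + 2 *\<^sub>R z)" by (simp add: scaleR_right_diff_distrib)
      also have "N \<dots> \<le> r" using xz W(2) unfolding V_def F_def by blast
      finally show "N (x - z) \<le> r / 2" by simp
    qed
    ultimately show ?thesis
      by (meson card_image_le card_mono finite_imageI finite_subset le_trans)
  qed auto
  have eq: "W = (\<Union>P\<in>Pow C. F P)" unfolding F_def using p(1) by auto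
  then have "card W \<le> (\<Sum>P\<in>Pow C. card (F P))"
    using card_UN_le[of "Pow C" F] C(1) by simp
  also have "\<dots> \<le> card (Pow C) * k"
    using sum_bounded_above[of "Pow C" "\<lambda>P. card (F P)" k] F by simp
  also have "\<dots> = 2 ^ card C * k" using C(1) by (simp add: card_Pow)
  also have "\<dots> \<le> 2 ^ dim (short r) * k" using cardC by (simp add: power_increasing)
  finally have "card W \<le> 2 ^ dim (short r) * k" .
  moreover have "finite W" unfolding eq using F C(1) by blast
  ultimately show ?thesis by blast
qed auto

text \<open>Induction on the number \<open>j\<close> of halvings still to come. At diameter
  \<open>2 / 2 ^ J\<close> the gap leaves a single point, and each level before that contributes one
  factor from \<open>card_halving\<close>.\<close>

lemma card_le_prod:
  assumes gap: "\<And>m. m \<in> E \<Longrightarrow> N m \<le> 2 / 2 ^ J \<Longrightarrow> m = 0"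
    and "a + j = J" "W \<subseteq> E" "\<And>x y. x \<in> W \<Longrightarrow> y \<in> W \<Longrightarrow> N (x - y) \<le> 2 / 2 ^ a"
  shows "finite W \<and> card W \<le> (\<Prod>a = a..<J. 2 ^ dim (short (2 / 2 ^ a)))"
  using assms(2-)
proof (induction j arbitrary: a W)
  case 0
  have "x = y" if "x \<in> W" "y \<in> W" for x y
    using gap[of "x - y"] 0 that int_subgroup.diff[OF int_subgroup_lattice, of x y] by auto
  then have "finite W \<and> card W \<le> 1"
    by (metis card_le_Suc0_iff_eq finite.emptyI finite_insert finite_subset insertCI One_nat_def subsetI)
  then show ?case using 0 by simp
next
  case (Suc j)
  have "finite W \<and> card W
      \<le> 2 ^ dim (short (2 / 2 ^ a)) * (\<Prod>a = Suc a..<J. 2 ^ dim (short (2 / 2 ^ a)))"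
  proof (rule card_halving)
    fix V assume "V \<subseteq> E" "\<And>x y. x \<in> V \<Longrightarrow> y \<in> V \<Longrightarrow> N (x - y) \<le> 2 / 2 ^ a / 2"
    then show "finite V \<and> card V \<le> (\<Prod>a = Suc a..<J. 2 ^ dim (short (2 / 2 ^ a)))"
      using Suc.prems(1) by (intro Suc.IH) (auto simp: mult.commute)
  qed (use Suc.prems in auto)
  then show ?case using Suc.prems(1) by (simp add: prod.atLeast_Suc_lessThan)
qed

lemma card_short_le:
  assumes "n \<ge> 1"
  shows "\<exists>J. card (short 1) \<le> (\<Prod>a<J. 2 ^ dim (short (2 / 2 ^ a)))"
proof -
  have l: "succ_min E N 1 > 0" using succ_min_props(1)[of 1] assms by simp
  \<comment> \<open>\<open>J\<close> is taken so large that the final diameter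
    \<open>2 / 2 ^ J\<close> drops below the first minimum; the initial diameter 2 comes from the
    triangle inequality.\<close>
  obtain J where "(1 / 2) ^ J < succ_min E N 1 / 2"
    using real_arch_pow_inv[of "succ_min E N 1 / 2" "1 / 2"] l by auto
  then have J: "2 / 2 ^ J < succ_min E N 1" by (simp add: power_one_over field_simps)
  have "finite (short 1) \<and> card (short 1) \<le> (\<Prod>a = 0..<J. 2 ^ dim (short (2 / 2 ^ a)))"
  proof (rule card_le_prod)
    fix m assume "m \<in> E" "N m \<le> 2 / 2 ^ J"
    then show "m = 0" using succ_min_1_le[of m] J by force
  next
    fix x y assume "x \<in> short 1" "y \<in> short 1"
    then show "N (x - y) \<le> 2 / 2 ^ 0"
      using norm_on_diff_le[OF norm_span, of x y] short_subset[of 1] unfolding short_def by force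
  qed (auto simp: short_def)
  then show ?thesis by (auto simp: atLeast0LessThan)
qed

text \<open>Exchanging the product over scales with the product over indices gives each minimum its
  own power of 2, which together with \<open>min (succ_min E N i) 1\<close> is at most 4.\<close>

lemma h0_hat_upper_bound:
  assumes "n \<ge> 1"
  shows "h0_hat E N + (\<Sum>i = 1..n. ln (min (succ_min E N i) 1)) \<le> real n * ln 4"
proof -
  let ?l = "succ_min E N"
  define S where "S = short 1"
  obtain J where J: "card S \<le> (\<Prod>a<J. 2 ^ dim (short (2 / 2 ^ a)))"
    using card_short_le[OF assms] unfolding S_def by blast
  have pos: "?l i > 0" if "i \<in> {1..n}" for i using succ_min_props(1) that by simp
  then have minpos: "min (?l i) 1 > 0" if "i \<in> {1..n}" for i using that by simp
  have "real (card S) \<le> real (\<Prod>a<J. 2 ^ dim (short (2 / 2 ^ a)))"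
    using J by (simp only: of_nat_le_iff)
  also have "\<dots> = (\<Prod>a<J. 2 ^ dim (short (2 / 2 ^ a)))" by simp
  \<comment> \<open>The exponent counts the indices whose minimum is at most
    \<open>2 / 2 ^ a\<close>, so the power splits into one factor per index.\<close>
  also have "\<dots> = (\<Prod>a<J. \<Prod>i = 1..n. if ?l i \<le> 2 / 2 ^ a then 2 else 1)"
    by (intro prod.cong refl, subst dim_short_eq_card)
      (auto simp: prod.If_cases Int_def)
  also have "\<dots> = (\<Prod>i = 1..n. \<Prod>a<J. if ?l i \<le> 2 / 2 ^ a then 2 else 1)"
    by (rule prod.swap)
  also have "\<dots> = (\<Prod>i = 1..n. 2 ^ card {a. a < J \<and> ?l i \<le> 2 / 2 ^ a})"
    by (simp add: prod.If_cases Int_def)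
  finally have "real (card S) * (\<Prod>i = 1..n. min (?l i) 1)
      \<le> (\<Prod>i = 1..n. 2 ^ card {a. a < J \<and> ?l i \<le> 2 / 2 ^ a}) * (\<Prod>i = 1..n. min (?l i) 1)"
    by (intro mult_right_mono prod_nonneg less_imp_le[OF minpos]) auto
  also have "\<dots> = (\<Prod>i = 1..n. 2 ^ card {a. a < J \<and> ?l i \<le> 2 / 2 ^ a} * min (?l i) 1)"
    by (simp add: prod.distrib)
  also have "\<dots> \<le> (\<Prod>i = 1..n. 4)"
  proof (rule prod_mono)
    fix i assume "i \<in> {1..n}"
    then have "?l i > 0" by (rule pos)
    from two_power_card_times_min_le[OF this] this
    show "0 \<le> 2 ^ card {a. a < J \<and> ?l i \<le> 2 / 2 ^ a} * min (?l i) 1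
      \<and> 2 ^ card {a. a < J \<and> ?l i \<le> 2 / 2 ^ a} * min (?l i) 1 \<le> 4"
      by simp
  qed
  finally have le: "real (card S) * (\<Prod>i = 1..n. min (?l i) 1) \<le> 4 ^ n" by simp
  have cS: "card S > 0"
    unfolding S_def using finite_short zero_in_short[of 1]
    by (auto simp: card_gt_0_iff)
  have pp: "(\<Prod>i = 1..n. min (?l i) 1) > 0" by (intro prod_pos minpos)
  have "h0_hat E N + (\<Sum>i = 1..n. ln (min (?l i) 1))
      = ln (real (card S)) + ln (\<Prod>i = 1..n. min (?l i) 1)"
    unfolding h0_hat_def S_def short_def
    by (subst ln_prod) (use less_imp_neq[OF minpos, symmetric] in simp_all)
  also have "\<dots> = ln (real (card S) * (\<Prod>i = 1..n. min (?l i) 1))"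
    using cS pp by (simp add: ln_mult_pos)
  also have "\<dots> \<le> ln (4 ^ n)" using le cS pp by (subst ln_le_cancel_iff) auto
  finally show ?thesis by (simp add: ln_realpow)
qed

section \<open>Lower bound from independent short vectors\<close>

lemma succ_min_vectors:
  assumes "k \<le> n"
  shows "\<exists>v. inj_on v {1..k} \<and> independent (v ` {1..k}) \<and>
    (\<forall>i\<in>{1..k}. v i \<in> E \<and> N (v i) \<le> succ_min E N i)"
  using assms
proof (induction k)
  case 0
  then show ?case by (simp add: independent_empty)
next
  case (Suc k)
  then obtain v where v: "inj_on v {1..k}" "independent (v ` {1..k})"
    "\<And>i. i \<in> {1..k} \<Longrightarrow> v i \<in> E \<and> N (v i) \<le> succ_min E N i"
    by auto
  let ?S = "short (succ_min E N (Suc k))"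
  \<comment> \<open>Since the minimum is attained, \<open>?S\<close> has dimension at least
    \<open>k + 1\<close>, so the \<open>k\<close> vectors chosen so far cannot span it; any point
    outside their span extends the family.\<close>
  have "\<not> ?S \<subseteq> span (v ` {1..k})"
  proof
    assume "?S \<subseteq> span (v ` {1..k})"
    then have "dim ?S \<le> card (v ` {1..k})" by (rule real_vector.dim_le_card) simp
    also have "\<dots> \<le> k" using card_image_le[of "{1..k}" v] by simp
    finally show False using succ_min_props(2)[of "Suc k"] Suc.prems by simp
  qed
  then obtain w where w: "w \<in> ?S" "w \<notin> span (v ` {1..k})" by blast
  define u where "u = v(Suc k := w)"
  have u: "u i = v i" if "i \<in> {1..k}" for i using that unfolding u_def by auto
  then have img: "u ` {1..k} = v ` {1..k}" by auto
  have ins: "{1..Suc k} = insert (Suc k) {1..k}" by auto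
  have "w \<notin> v ` {1..k}" using w span_base by blast
  then have "inj_on u {1..Suc k}"
    unfolding ins using v(1) u img inj_on_cong[of "{1..k}" u v] by (auto simp: u_def)
  moreover have "independent (u ` {1..Suc k})"
    unfolding ins image_insert img using v(2) w(2) by (auto simp: u_def independent_insert)
  moreover have "\<forall>i\<in>{1..Suc k}. u i \<in> E \<and> N (u i) \<le> succ_min E N i"
    unfolding ins using v(3) u w by (auto simp: u_def short_def)
  ultimately show ?case by blast
qed

lemma h0_hat_lower_bound:
  assumes "n \<ge> 1"
  shows "- real n * ln (real n) \<le> h0_hat E N + (\<Sum>i = 1..n. ln (min (succ_min E N i) 1))"
proof -
  let ?l = "succ_min E N"
  interpret E: int_subgroup E by (rule int_subgroup_lattice)
  define I where "I = {i \<in> {1..n}. ?l i \<le> 1}"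
  have I: "finite I" "I \<subseteq> {1..n}" unfolding I_def by auto
  then have cardI: "card I \<le> n" using card_mono[OF _ I(2)] by simp
  have pos: "?l i > 0" if "i \<in> I" for i using succ_min_props(1) that I by auto
  obtain v where v: "inj_on v {1..n}" "independent (v ` {1..n})"
    "\<And>i. i \<in> {1..n} \<Longrightarrow> v i \<in> E" "\<And>i. i \<in> {1..n} \<Longrightarrow> N (v i) \<le> ?l i"
    using succ_min_vectors[of n] by auto
  \<comment> \<open>With coefficients up to \<open>q i\<close> each summand has norm at most
    \<open>1 / n\<close>, and at most \<open>n\<close> summands occur.\<close>
  define q where "q i = \<lfloor>1 / (real n * ?l i)\<rfloor>" for i
  have q0: "q i \<ge> 0" if "i \<in> I" for i
    unfolding q_def using pos[OF that] by simp
  define P where "P = (\<Pi>\<^sub>E i\<in>I. {- q i..q i})"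
  define f where "f c = (\<Sum>i\<in>I. of_int (c i) *\<^sub>R v i)" for c :: "nat \<Rightarrow> int"
  have "inj_on f P"
  proof (rule inj_onI)
    fix c e assume ce: "c \<in> P" "e \<in> P" "f c = f e"
    have injI: "inj_on v I" using v(1) I(2) inj_on_subset by blast
    \<comment> \<open>Independence concerns the set of vectors, so the coefficient differences are
      carried from indices to vectors through the inverse of \<open>v\<close>.\<close>
    define h where "h w = real_of_int (c (the_inv_into I v w) - e (the_inv_into I v w))" for w
    have h: "h (v i) = real_of_int (c i - e i)" if "i \<in> I" for i
      unfolding h_def using the_inv_into_f_f[OF injI that] by simp
    have "(\<Sum>w\<in>v ` I. h w *\<^sub>R w) = (\<Sum>i\<in>I. of_int (c i - e i) *\<^sub>R v i)"
      by (subst sum.reindex[OF injI]) (simp add: h)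
    also have "\<dots> = f c - f e"
      unfolding f_def by (simp add: sum_subtractf scaleR_left_diff_distrib)
    finally have z: "(\<Sum>w\<in>v ` I. h w *\<^sub>R w) = 0" using ce by simp
    have "c i = e i" if "i \<in> I" for i
    proof -
      have "h (v i) = 0"
        by (rule real_vector.independentD[OF v(2) _ _ z]) (use I that in auto)
      then show ?thesis using h[OF that] by simp
    qed
    then show "c = e" using ce(1,2) unfolding P_def by (intro PiE_ext) auto
  qed
  moreover have "f ` P \<subseteq> short 1"
  proof (rule image_subsetI)
    fix c assume c: "c \<in> P"
    have vs: "v i \<in> span E" if "i \<in> I" for i using v(3) I that span_base by blast
    have "N (f c) \<le> (\<Sum>i\<in>I. N (of_int (c i) *\<^sub>R v i))"
      unfolding f_def by (rule norm_on_sum_le[OF norm_span]) (intro span_scale vs)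
    also have "\<dots> \<le> (\<Sum>i\<in>I. 1 / real n)"
    proof (rule sum_mono)
      fix i assume i: "i \<in> I"
      have "\<bar>c i\<bar> \<le> q i" using c i unfolding P_def by (force dest: PiE_mem)
      then have "real_of_int \<bar>c i\<bar> \<le> 1 / (real n * ?l i)"
        unfolding q_def by (simp add: le_floor_iff)
      then have "real_of_int \<bar>c i\<bar> * N (v i) \<le> 1 / (real n * ?l i) * ?l i"
        using v(4)[of i] i I norm_onD(1)[OF norm_span vs[OF i]] pos[OF i]
        by (intro mult_mono) auto
      also have "\<dots> = 1 / real n" using pos[OF i] by simp
      finally show "N (of_int (c i) *\<^sub>R v i) \<le> 1 / real n"
        using norm_onD(4)[OF norm_span vs[OF i]] by simp
    qed
    also have "\<dots> \<le> 1" using cardI assms by simp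
    finally show "f c \<in> short 1"
      unfolding short_def f_def using v(3) I by (auto intro!: E.sum E.scale)
  qed
  ultimately have "card P \<le> card (short 1)"
    using card_inj_on_le finite_short by blast
  moreover have "real (card P) = (\<Prod>i\<in>I. real (card {- q i..q i}))"
    unfolding P_def by (simp add: card_PiE I(1))
  ultimately have "(\<Prod>i\<in>I. real (card {- q i..q i})) \<le> real (card (short 1))"
    by linarith
  moreover have "(\<Prod>i\<in>I. 1 / (real n * ?l i)) \<le> (\<Prod>i\<in>I. real (card {- q i..q i}))"
  proof (rule prod_mono)
    fix i assume i: "i \<in> I"
    \<comment> \<open>The interval has \<open>2 * q i + 1\<close> elements, and this is at least
      \<open>q i + 1\<close> even when \<open>q i = 0\<close>; the rounding in the floor thus loses
      nothing in the bound.\<close>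
    have "1 / (real n * ?l i) \<le> real_of_int (q i) + 1" unfolding q_def by linarith
    also have "\<dots> \<le> real (card {- q i..q i})" using q0[OF i] by simp
    finally show "0 \<le> 1 / (real n * ?l i) \<and> 1 / (real n * ?l i) \<le> real (card {- q i..q i})"
      using pos[OF i] by simp
  qed
  ultimately have le: "(\<Prod>i\<in>I. 1 / (real n * ?l i)) \<le> real (card (short 1))" by linarith
  have "- real n * ln (real n) \<le> - real (card I) * ln (real n)"
    using cardI assms by (simp add: mult_right_mono)
  also have "\<dots> = (\<Sum>i\<in>I. ln (1 / (real n * ?l i))) + (\<Sum>i\<in>I. ln (?l i))"
  proof -
    have "ln (1 / (real n * ?l i)) + ln (?l i) = - ln (real n)" if "i \<in> I" for i
      using pos[OF that] assms by (simp add: ln_div ln_mult_pos)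
    then show ?thesis by (simp flip: sum.distrib)
  qed
  also have "(\<Sum>i\<in>I. ln (1 / (real n * ?l i))) = ln (\<Prod>i\<in>I. 1 / (real n * ?l i))"
    by (subst ln_prod) (use I(1) less_imp_neq[OF pos, symmetric] assms in auto)
  also have "\<dots> \<le> ln (real (card (short 1)))"
    using le by (intro ln_mono prod_pos) (use pos assms in auto)
  also have "ln (real (card (short 1))) = h0_hat E N" unfolding h0_hat_def short_def ..
  \<comment> \<open>Indices outside \<open>I\<close> have minimum above 1 and contribute
    \<open>ln 1 = 0\<close>.\<close>
  also have "(\<Sum>i\<in>I. ln (?l i)) = (\<Sum>i = 1..n. ln (min (?l i) 1))"
    unfolding I_def by (rule sum.mono_neutral_cong_left) (auto simp: min_def)
  finally show ?thesis by simp
qed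

end

section \<open>Comparison with the stated constants\<close>

theorem corollary4p3:
  fixes E :: "'a::real_vector set" and N :: "'a \<Rightarrow> real" and n :: nat
  assumes "normed_lattice E N n" and "n \<ge> 1"
  shows "- pi - ln (fact n) + real n / 2 * ln (2 / (exp 1 * pi)) - real n * ln (real n)
           + ln (1 - 1 / (2 * pi))
         \<le> h0_hat E N + (\<Sum>i = 1..n. ln (min (succ_min E N i) 1))
       \<and> h0_hat E N + (\<Sum>i = 1..n. ln (min (succ_min E N i) 1))
         \<le> 2 * pi - 2 * ln (1 - 1 / (2 * pi)) + 3 * real n / 2 * ln (real n)"
proof
  have pi: "pi \<ge> 2" by (rule pi_ge_two)
  \<comment> \<open>On the lower side every term besides \<open>- real n * ln (real n)\<close> is at
    most 0, so the counting bound suffices.\<close>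
  have c: "ln (1 - 1 / (2 * pi)) \<le> 0" using pi by (intro ln_le_zero_iff[THEN iffD2]) (auto simp: field_simps)
  have "exp 1 * pi \<ge> 1 * 2" using pi by (intro mult_mono) auto
  then have "ln (2 / (exp 1 * pi)) \<le> 0" using pi by (simp add: ln_le_zero_iff field_simps)
  then have "real n / 2 * ln (2 / (exp 1 * pi)) \<le> 0" by (intro mult_nonneg_nonpos) auto
  moreover have "ln (fact n :: real) \<ge> 0" using fact_ge_1[of n] by (intro ln_ge_zero)
  ultimately show "- pi - ln (fact n) + real n / 2 * ln (2 / (exp 1 * pi)) - real n * ln (real n)
           + ln (1 - 1 / (2 * pi)) \<le> h0_hat E N + (\<Sum>i = 1..n. ln (min (succ_min E N i) 1))"
    using h0_hat_lower_bound[OF assms] pi c by linarith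
  \<comment> \<open>The constant part of the upper bound is at least 4, by \<open>pi \<ge> 2\<close>
    and the sign of the logarithm in \<open>c\<close>. For \<open>n \<ge> 3\<close> the inequality
    rests on \<open>4 ^ 2 \<le> 3 ^ 3\<close>, for smaller \<open>n\<close> on
    \<open>ln 4 \<le> 2\<close>.\<close>
  have "real n * ln 4 \<le> 4 + 3 * real n / 2 * ln (real n)"
  proof (cases "n \<ge> 3")
    case True
    have "2 * ln (4::real) = ln (4 ^ 2)" using ln_realpow[of 4 2] by simp
    also have "\<dots> \<le> ln (3 ^ 3)" by simp
    also have "\<dots> = 3 * ln (3::real)" using ln_realpow[of 3 3] by simp
    also have "\<dots> \<le> 3 * ln (real n)" using True by simp
    finally have "real n * ln 4 \<le> real n * (3 / 2 * ln (real n))" by (intro mult_left_mono) auto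
    then show ?thesis by simp
  next
    case False
    have "ln (4::real) = 2 * ln 2" using ln_realpow[of 2 2] by simp
    then have "ln (4::real) \<le> 2" using ln_le_minus_one[of 2] by simp
    then have "real n * ln 4 \<le> 2 * 2" using False by (intro mult_mono) auto
    moreover have "3 * real n / 2 * ln (real n) \<ge> 0" using assms by simp
    ultimately show ?thesis by linarith
  qed
  then show "h0_hat E N + (\<Sum>i = 1..n. ln (min (succ_min E N i) 1))
         \<le> 2 * pi - 2 * ln (1 - 1 / (2 * pi)) + 3 * real n / 2 * ln (real n)"
    using h0_hat_upper_bound[OF assms] pi c by linarith
qed

end
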